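(* Let $n\ge2$, $m\ge1$, let $s_1,\dots,s_m$ be positive integers, and let $p=b_1\otimes\cdots\otimes b_m\in B^{1,s_1}\otimes\cdots\otimes B^{1,s_m}$ be a length $m$ path of type $\hat{\mathfrak{sl}}_n$. Then the number of solitons contained in $p$ is at most $$\left\lceil\frac{(n-1)m}{n}\right\rceil .$$
   Context: **Crystals.** $B^{1,s}$ is, as a set, the set of one-row semistandard tableaux (weakly increasing words) of length $s$ with letters in $\{1,\dots,n\}$. $B^{1,s_1}\otimes\cdots\otimes B^{1,s_m}$ is, as a set, the Cartesian product. Put $I_0=\{1,\dots,n-1\}$. **Solitons.** The lengths of the solitons of the box-ball system state $p$ are the nonzero parts of the first partition $\nu^{(1)}$ of the rigged configuration $\Phi(p)$; thus the number of solitons contained in $p$ is the number of nonzero parts of $\nu^{(1)}$. **Rigged configuration bijection $\Phi$.** A configuration is $(\nu,J)=\{(\nu^{(0)}),(\nu^{(1)},J^{(1)}),\dots,(\nu^{(n-1)},J^{(n-1)})\}$ with $\nu^{(a)}$ partitions, viewed as multisets of rows; each row $\nu^{(a)}_i$ with $a\in I_0$ carries an integer rigging $J^{(a)}_i$, and the pair $(\nu^{(a)}_i,J^{(a)}_i)$ is called a string. Put $\nu^{(n)}=\emptyset$, $Q_k(\nu^{(a)})=\sum_i\min(k,\nu^{(a)}_i)$, and define the vacancy number $P^{(a)}_k(\nu)=Q_k(\nu^{(a-1)})-2Q_k(\nu^{(a)})+Q_k(\nu^{(a+1)})$. A string is singular if $J^{(a)}_i=P^{(a)}_{\nu^{(a)}_i}(\nu)$.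 By convention every $(\nu^{(a)},J^{(a)})$, $a\in I_0$, always also contains empty (length zero) strings $(0,0)$, which are singular. $\Phi(p)$ is built recursively, starting from the empty configuration, by processing $b_1,b_2,\dots,b_m$ in this order. For each $b_i=c_{s_i}\cdots c_2c_1$ (weakly increasing from left to right), process the letters $c_1,c_2,\dots,c_{s_i}$ in this order. Given the current configuration $(\eta,I)$, the letter $c=c_k$ is processed as follows. 1. If $c\ge2$, let $\ell^{(c-1)}$ be the length of the largest singular string of $(\eta^{(c-1)},I^{(c-1)})$. 2. For $a=c-1,c-2,\dots,2$ successively, let $\ell^{(a-1)}$ be the length of the largest singular string of $(\eta^{(a-1)},I^{(a-1)})$ whose length does not exceed $\ell^{(a)}$. 3. For each $1\le a\le c-1$ add one box to one singular string of length $\ell^{(a)}$ of $(\eta^{(a)},I^{(a)})$. In $\eta^{(0)}$ add one box to a row of length $k-1$ (a new row of length 1 if $k=1$). This yields $\eta'$. (If $c=1$ only $\eta^{(0)}$ changes.) 4. Unchanged rows keep their riggings; each changed row of $\eta'^{(a)}$, $a\in I_0$, receives the rigging making it singular with respect to $\eta'$. *)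

theory Defs
  imports Complex_Main "HOL-Library.Multiset"
begin

text \<open>As a set, \<open>B\<^bsup>1,s\<^esup>\<close> is the set of one-row semistandard tableaux of length \<open>s\<close>; a tableau is
  the list of its letters from left to right. The tensor product of crystals is, as a set, the
  Cartesian product, whose elements are lists of tableaux.\<close>

definition row_crystal :: "nat \<Rightarrow> nat \<Rightarrow> nat list set" where
  "row_crystal n s = {w. length w = s \<and> sorted w \<and> set w \<subseteq> {1..n}}"

definition paths :: "nat \<Rightarrow> nat list \<Rightarrow> nat list list set" where
  "paths n ss = listset (map (row_crystal n) ss)"

text \<open>\<open>rows0\<close> is \<open>\<nu>\<^bsup>(0)\<^esup>\<close>, and \<open>strings C a\<close> is the multiset of pairs (row length, rigging) of
  \<open>(\<nu>\<^bsup>(a)\<^esup>, J\<^bsup>(a)\<^esup>)\<close>, used only for \<open>1 \<le> a < n\<close>. Only rows of positive length are stored: the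
  empty strings \<open>(0, 0)\<close> that are always present are accounted for in \<open>singular\<close> and in
  \<open>process_letter\<close>.\<close>

datatype configuration =
  Configuration (rows0: "nat multiset") (strings: "nat \<Rightarrow> (nat \<times> int) multiset")

definition empty_configuration :: configuration where
  "empty_configuration = Configuration {#} (\<lambda>_. {#})"

definition shape :: "nat \<Rightarrow> configuration \<Rightarrow> nat \<Rightarrow> nat multiset" where
  "shape n C a =
     (if a = 0 then rows0 C else if a < n then image_mset fst (strings C a) else {#})"

definition Q :: "nat \<Rightarrow> nat multiset \<Rightarrow> int" where
  "Q k R = (\<Sum>r\<in>#R. int (min k r))"

text \<open>The vacancy number depends only on the shapes \<open>\<nu>\<^bsup>(a)\<^esup>\<close>, and is used only for \<open>1 \<le> a < n\<close>.\<close>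

definition vacancy :: "(nat \<Rightarrow> nat multiset) \<Rightarrow> nat \<Rightarrow> nat \<Rightarrow> int" where
  "vacancy \<nu> a k = Q k (\<nu> (a - 1)) - 2 * Q k (\<nu> a) + Q k (\<nu> (a + 1))"

definition singular :: "nat \<Rightarrow> configuration \<Rightarrow> nat \<Rightarrow> nat \<Rightarrow> bool" where
  "singular n C a l \<longleftrightarrow> l = 0 \<or> (l, vacancy (shape n C) a l) \<in># strings C a"

text \<open>\<open>selected_below n C c d\<close> is the length \<open>l\<^bsup>(a)\<^esup>\<close> for \<open>a = c - 1 - d\<close>; the selection
  runs downwards in \<open>a\<close>.\<close>

primrec selected_below :: "nat \<Rightarrow> configuration \<Rightarrow> nat \<Rightarrow> nat \<Rightarrow> nat" where
  "selected_below n C c 0 = Max {l. singular n C (c - 1) l}"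
| "selected_below n C c (Suc d) =
     Max {l. singular n C (c - 1 - Suc d) l \<and> l \<le> selected_below n C c d}"

definition selected :: "nat \<Rightarrow> configuration \<Rightarrow> nat \<Rightarrow> nat \<Rightarrow> nat" where
  "selected n C c a = selected_below n C c (c - 1 - a)"

text \<open>Multiset subtraction is truncated: since rows of length 0 are not stored, adding a box to
  an empty row or string (\<open>l = 0\<close>) just creates a new one of length 1.\<close>

definition add_box :: "nat \<Rightarrow> nat multiset \<Rightarrow> nat multiset" where
  "add_box l R = (R - {#l#}) + {#l + 1#}"

definition process_letter :: "nat \<Rightarrow> nat \<Rightarrow> nat \<Rightarrow> configuration \<Rightarrow> configuration" where
  "process_letter n k c C =
    (let \<eta> = shape n C;
         len = selected n C c;
         \<eta>' = (\<lambda>a. if a = 0 then add_box (k - 1) (\<eta> 0)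
                    else if a \<le> c - 1 then add_box (len a) (\<eta> a)
                    else \<eta> a)
     in Configuration (\<eta>' 0)
          (\<lambda>a. if 1 \<le> a \<and> a \<le> c - 1
                then (strings C a - {#(len a, vacancy \<eta> a (len a))#})
                       + {#(len a + 1, vacancy \<eta>' a (len a + 1))#}
                else strings C a))"

text \<open>The letters of \<open>b = c\<^sub>s \<dots> c\<^sub>1\<close> are processed from right to left, with \<open>c\<^sub>k\<close> in position \<open>k\<close>.\<close>

definition process_row :: "nat \<Rightarrow> nat list \<Rightarrow> configuration \<Rightarrow> configuration" where
  "process_row n b = fold (\<lambda>(k, c). process_letter n k c) (enumerate 1 (rev b))"

definition Phi :: "nat \<Rightarrow> nat list list \<Rightarrow> configuration" where
  "Phi n p = fold (process_row n) p empty_configuration"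

definition soliton_lengths :: "nat \<Rightarrow> nat list list \<Rightarrow> nat multiset" where
  "soliton_lengths n p = filter_mset (\<lambda>r. r \<noteq> 0) (shape n (Phi n p) 1)"

definition num_solitons :: "nat \<Rightarrow> nat list list \<Rightarrow> nat" where
  "num_solitons n p = size (soliton_lengths n p)"

end

theory Submission
  imports Defs
begin

text \<open>Call \<open>1 \<le> u\<^sub>1 \<le> \<dots> \<le> u\<^sub>t\<close> a chain of length \<open>t\<close> if \<open>u\<^sub>a\<close> is the length of a singular string of
  \<open>\<nu>\<^bsup>(a)\<^esup>\<close>; then \<open>t \<le> n - 1\<close>, and \<open>t + 1\<close> plays the role of the letter of a carrier of capacity one.
  A letter \<open>c\<close> creates a new row of \<open>\<nu>\<^bsup>(1)\<^esup>\<close> only if there is no chain of length \<open>c - 1\<close>. After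
  \<open>c\<close> has been processed there is such a chain, so among the weakly decreasing letters of one tableau
  only the first can create a new row. If it does, any chain of length \<open>t\<close> present before the tableau
  leads to one of length \<open>t + 1\<close> after it. Hence at least one of any \<open>n\<close> consecutive tableaux creates no row, and
  the number of rows is at most \<open>m - \<lfloor>m / n\<rfloor>\<close>.\<close>

section \<open>Box counts and singular strings\<close>

lemma Q_add_box:
  assumes "l = 0 \<or> l \<in># R"
  shows "Q i (add_box l R) = Q i R + (if l < i then 1 else 0)"
proof (cases "l \<in># R")
  case True
  then obtain R' where "R = add_mset l R'"
    by (meson mset_add)
  then show ?thesis
    by (auto simp: Q_def add_box_def min_def)
next
  case False
  with assms show ?thesis
    by (auto simp: Q_def add_box_def min_def diff_single_trivial)
qed

text \<open>A multiplicity rather than a predicate: of two equal singular strings, one can survive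
  when the other is lengthened. The implicit empty strings are not counted.\<close>

definition sing :: "nat \<Rightarrow> configuration \<Rightarrow> nat \<Rightarrow> nat \<Rightarrow> nat" where
  "sing n C a i = count (strings C a) (i, vacancy (shape n C) a i)"

lemma singular_iff_sing: "singular n C a i \<longleftrightarrow> i = 0 \<or> 0 < sing n C a i"
  by (simp add: singular_def sing_def)

lemma finite_singular: "finite {l. singular n C a l}"
proof (rule finite_subset)
  show "{l. singular n C a l} \<subseteq> insert 0 (fst ` set_mset (strings C a))"
    by (force simp: singular_def)
qed simp

section \<open>Greedy selection, detached from configurations\<close>

text \<open>\<open>S a i\<close> is the number of singular strings of length \<open>i\<close> of \<open>\<nu>\<^bsup>(a)\<^esup>\<close>; \<open>l 0\<close> is left free for the
  length of the row of \<open>\<nu>\<^bsup>(0)\<^esup>\<close> that receives a box.\<close>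

locale selection =
  fixes S :: "nat \<Rightarrow> nat \<Rightarrow> nat" and c :: nat and l :: "nat \<Rightarrow> nat"
  assumes sel_singular: "1 \<le> a \<Longrightarrow> a < c \<Longrightarrow> l a = 0 \<or> 0 < S a (l a)"
    and sel_mono: "1 \<le> a \<Longrightarrow> a + 1 < c \<Longrightarrow> l a \<le> l (a + 1)"
    and sel_max: "1 \<le> a \<Longrightarrow> a < c \<Longrightarrow> 0 < S a i \<Longrightarrow> (a + 1 < c \<Longrightarrow> i \<le> l (a + 1)) \<Longrightarrow> i \<le> l a"
begin

text \<open>Descending induction from \<open>b\<close>: once \<open>v (a + 1)\<close> is at most
  \<open>l (a + 1)\<close>, the length \<open>v a\<close> is itself a candidate for
  \<open>l a\<close>. For \<open>b + 1 = c\<close> the last hypothesis is void, since the first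
  choice has no upper bound.\<close>

lemma chain_le_selected:
  assumes "1 \<le> a" "a \<le> b" "b < c"
    and "\<And>j. 1 \<le> j \<Longrightarrow> j \<le> b \<Longrightarrow> 0 < S j (v j)"
    and "\<And>j. 1 \<le> j \<Longrightarrow> j < b \<Longrightarrow> v j \<le> v (j + 1)"
    and "b + 1 < c \<Longrightarrow> v b \<le> l (b + 1)"
  shows "v a \<le> l a"
  using assms(2,1)
proof (induction rule: inc_induct)
  case base
  then show ?case using assms sel_max by auto
next
  case (step j)
  have "v (Suc j) \<le> l (Suc j)" "v j \<le> v (Suc j)"
    using step assms(5)[of j] by auto
  then show ?case using step assms(3) assms(4)[of j] by (auto intro!: sel_max[of j "v j"])
qed

end

lemma selection_selected:
  assumes "\<And>a. 1 \<le> a \<Longrightarrow> l a = selected n C c a"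
  shows "selection (sing n C) c l"
proof
  have top: "selected n C c a = Max {i. singular n C a i}" if "1 \<le> a" "a < c" "\<not> a + 1 < c" for a
  proof -
    have "a = c - 1" using that by simp
    then show ?thesis by (simp add: selected_def)
  qed
  have below: "selected n C c a = Max {i. singular n C a i \<and> i \<le> selected n C c (a + 1)}"
    if "1 \<le> a" "a + 1 < c" for a
  proof -
    have "c - 1 - a = Suc (c - 1 - (a + 1))" "c - 1 - Suc (c - 1 - (a + 1)) = a"
      using that by auto
    then show ?thesis
      by (simp add: selected_def)
  qed
  define X where "X a = {i. singular n C a i \<and> (a + 1 < c \<longrightarrow> i \<le> selected n C c (a + 1))}" for a
  have M: "selected n C c a = Max (X a)" if "1 \<le> a" "a < c" for a
    using top[of a] below[of a] that by (cases "a + 1 < c") (auto simp: X_def)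
  have F: "finite (X a)" for a
    by (rule finite_subset[OF _ finite_singular[of n C a]]) (auto simp: X_def)
  have N: "X a \<noteq> {}" for a
    by (auto simp: X_def singular_def)
  have I: "selected n C c a \<in> X a" if "1 \<le> a" "a < c" for a
    using M[OF that] Max_in[OF F N] by simp
  show "l a = 0 \<or> 0 < sing n C a (l a)" if "1 \<le> a" "a < c" for a
    using I[OF that] that assms by (auto simp: X_def singular_iff_sing)
  show "l a \<le> l (a + 1)" if "1 \<le> a" "a + 1 < c" for a
    using I[of a] that assms by (auto simp: X_def)
  show "i \<le> l a" if "1 \<le> a" "a < c" "0 < sing n C a i" "a + 1 < c \<Longrightarrow> i \<le> l (a + 1)" for a i
    using Max_ge[OF F[of a], of i] M[of a] that assms by (auto simp: X_def singular_iff_sing)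
qed

section \<open>How one letter changes chains\<close>

text \<open>Passing from \<open>S\<close> to \<open>S'\<close>, only those singular strings are known to survive whose vacancy
  number does not change.\<close>

locale letter_step = selection +
  fixes S' :: "nat \<Rightarrow> nat \<Rightarrow> nat"
  assumes survive: "1 \<le> a \<Longrightarrow> a < c \<Longrightarrow> 1 \<le> i \<Longrightarrow> i \<le> l (a - 1) \<or> (a + 1 < c \<and> l (a + 1) < i) \<Longrightarrow>
      S a i + (if i = l a + 1 then 1 else 0) \<le> S' a i + (if i = l a then 1 else 0)"
    and new_string: "1 \<le> a \<Longrightarrow> a < c \<Longrightarrow> 0 < S' a (l a + 1)"
    and survive_top: "1 \<le> i \<Longrightarrow> i \<le> l (c - 1) \<Longrightarrow> S c i \<le> S' c i"
    and survive_above: "c < a \<Longrightarrow> S' a i = S a i"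
    and pos: "1 \<le> c"
    and start: "2 \<le> c \<Longrightarrow> l 0 \<le> l 1"

text \<open>Inside a tableau, the chain that rules out new rows has \<open>k\<close> equal to the
  number of letters processed so far; elsewhere \<open>k\<close> is 1.\<close>

definition chain :: "(nat \<Rightarrow> nat \<Rightarrow> nat) \<Rightarrow> nat \<Rightarrow> nat \<Rightarrow> (nat \<Rightarrow> nat) \<Rightarrow> bool" where
  "chain S k t v \<longleftrightarrow> (\<forall>a. 1 \<le> a \<and> a \<le> t \<longrightarrow> k \<le> v a \<and> 0 < S a (v a))
     \<and> (\<forall>a. 1 \<le> a \<and> a < t \<longrightarrow> v a \<le> v (a + 1))"

lemma chain_zero [simp]: "chain S k 0 v"
  by (simp add: chain_def)

text \<open>A chain \<open>u\<close> of length \<open>x\<close> alone may be destroyed by a further letter of the same tableau. It can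
  be repaired from a second chain \<open>m\<close> lying above it; a further letter \<open>c\<close> needs \<open>m\<close> only below \<open>c\<close>
  and leaves it intact only there, which suffices because the letters decrease. The last condition says
  that \<open>u\<close> and \<open>m\<close> use different strings.\<close>

definition interlaced :: "(nat \<Rightarrow> nat \<Rightarrow> nat) \<Rightarrow> nat \<Rightarrow> nat \<Rightarrow> nat \<Rightarrow> (nat \<Rightarrow> nat) \<Rightarrow> (nat \<Rightarrow> nat) \<Rightarrow> bool"
  where
  "interlaced S k x y u m \<longleftrightarrow> chain S 1 x u \<and> u 1 \<le> k \<and> chain S 1 (y - 1) m
     \<and> (\<forall>a. 1 \<le> a \<and> a < y \<longrightarrow> u (a + 1) \<le> m a \<and> (u a = m a \<longrightarrow> 2 \<le> S a (m a)))"

lemma interlaced_mono: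
  "interlaced S k x y u m \<Longrightarrow> y' \<le> y \<Longrightarrow> interlaced S k x y' u m"
  by (auto simp: interlaced_def chain_def)

context letter_step
begin

lemma chain_selected: "2 \<le> c \<Longrightarrow> chain S' (l 0 + 1) (c - 1) (\<lambda>a. l a + 1)"
proof -
  assume "2 \<le> c"
  have "l 0 \<le> l a" if "1 \<le> a" "a < c" for a
    using that
  proof (induction a rule: dec_induct)
    case base
    then show ?case using start \<open>2 \<le> c\<close> by simp
  next
    case (step a)
    then show ?case using sel_mono[of a] by simp
  qed
  then show ?thesis
    using new_string sel_mono by (auto simp: chain_def)
qed

text \<open>If \<open>c \<le> t + 1\<close>, or if some \<open>l (a + 1)\<close> reached
  \<open>m a\<close>, greediness would give \<open>1 \<le> m 1 \<le> l 1 = 0\<close>. So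
  \<open>m\<close> lies above the selected lengths and survives, while the lengthened strings supply
  the longer chain.\<close>

lemma chain_interlaced:
  assumes m: "chain S 1 t m" and l: "l 0 = 0" "l 1 = 0" and c: "2 \<le> c"
  shows "t + 1 < c \<and> interlaced S' 1 (t + 1) (t + 1) (\<lambda>a. l a + 1) m"
proof -
  have less: "l (a + 1) < m a" if "1 \<le> a" "a \<le> t" "a + 1 < c" for a
  proof (rule ccontr)
    assume "\<not> l (a + 1) < m a"
    then have "m 1 \<le> l 1"
      using chain_le_selected[of 1 a m] that m by (auto simp: chain_def)
    then show False
      using l m that by (auto simp: chain_def)
  qed
  have tc: "t + 1 < c"
  proof (rule ccontr)
    assume "\<not> t + 1 < c"
    then have "m 1 \<le> l 1"
      using chain_le_selected[of 1 "c - 1" m] c m by (auto simp: chain_def)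
    then show False
      using l m c \<open>\<not> t + 1 < c\<close> by (auto simp: chain_def)
  qed
  \<comment> \<open>The summand 1 is the new string: if its length is \<open>m a\<close>, old and
    new string together give the multiplicity 2 demanded by \<open>interlaced\<close>.\<close>
  have sur: "S a (m a) + (if m a = l a + 1 then 1 else 0) \<le> S' a (m a)" if "1 \<le> a" "a \<le> t" for a
    using survive[of a "m a"] less[of a] sel_mono[of a] that tc m by (auto simp: chain_def)
  have "chain S' 1 (t + 1) (\<lambda>a. l a + 1)"
    using chain_selected[OF c] tc by (auto simp: chain_def)
  moreover have pos: "0 < S a (m a)" if "1 \<le> a" "a \<le> t" for a
    using m that by (auto simp: chain_def)
  have "0 < S' a (m a)" if "1 \<le> a" "a \<le> t" for a
    using pos[OF that] sur[OF that] by (auto split: if_splits)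
  then have "chain S' 1 t m"
    using m by (auto simp: chain_def)
  moreover have "2 \<le> S' a (m a)" if "1 \<le> a" "a \<le> t" "l a + 1 = m a" for a
    using pos[OF that(1,2)] sur[OF that(1,2)] that(3) by (auto split: if_splits)
  ultimately show ?thesis
    using tc less l by (auto simp: interlaced_def Suc_le_eq)
qed

lemma interlaced_step:
  assumes "interlaced S (l 0) x (min x c) u m"
  shows "\<exists>u' m'. interlaced S' (l 0 + 1) x (min x c) u' m'"
proof -
  define y where "y = min x c"
  \<comment> \<open>\<open>m a\<close> surely survives unless \<open>a\<close> is bad. The bad indices form an initial segment, on which \<open>u a\<close>
    (or its twin \<open>m a\<close>, if \<open>u a\<close> itself is lengthened) survives instead.\<close>
  define bad where "bad a \<longleftrightarrow> 1 \<le> a \<and> a < y \<and> (a + 1 < c \<longrightarrow> m a \<le> l (a + 1))" for a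
  \<comment> \<open>Below \<open>c\<close>, \<open>u a\<close> is kept on the bad segment and at the
    index just after it, except there if \<open>u a = l (a - 1) = l a\<close>: the only string of
    that length might then be the one lengthened.\<close>
  define u' where "u' a =
    (if a < c \<and> \<not> ((a = 1 \<or> bad (a - 1)) \<and> (bad a \<or> u a \<noteq> l (a - 1) \<or> l (a - 1) \<noteq> l a))
     then l a + 1 else u a)" for a
  define m' where "m' a = (if bad a then l a + 1 else m a)" for a
  have u: "1 \<le> u a" "0 < S a (u a)" if "1 \<le> a" "a \<le> x" for a
    using assms that by (auto simp: interlaced_def chain_def)
  have u_mono: "u a \<le> u (a + 1)" if "1 \<le> a" "a < x" for a
    using assms that by (auto simp: interlaced_def chain_def)
  have u1: "u 1 \<le> l 0"
    using assms by (auto simp: interlaced_def)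
  have m: "1 \<le> m a" "0 < S a (m a)" "u (a + 1) \<le> m a" "u a = m a \<Longrightarrow> 2 \<le> S a (m a)"
    if "1 \<le> a" "a < y" for a
    using assms that by (auto simp: interlaced_def chain_def y_def)
  have m_mono: "m a \<le> m (a + 1)" if "1 \<le> a" "a + 1 < y" for a
    using assms that by (auto simp: interlaced_def chain_def y_def)
  have y: "y \<le> x" "y \<le> c" "x < c \<Longrightarrow> y = x" "c \<le> x \<Longrightarrow> y = c"
    by (auto simp: y_def)
  have bad_le: "m a \<le> l a" if "bad a" for a
    using that sel_max[of a "m a"] m[of a] y by (auto simp: bad_def)
  have bad_down: "bad a" if "bad (a + 1)" "1 \<le> a" for a
    using bad_le[OF that(1)] m_mono[of a] that by (auto simp: bad_def)
  have good: "a + 1 < c" "l (a + 1) < m a" "l a < m a" if "1 \<le> a" "a < y" "\<not> bad a" for a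
    using that sel_mono[of a] by (auto simp: bad_def)
  have start_le: "l (a - 1) \<le> l a" if "1 \<le> a" "a < c" for a
    using start sel_mono[of "a - 1"] that by (cases "a = 1") auto
  have u_le: "u a \<le> l (a - 1)" if "1 \<le> a" "a = 1 \<or> bad (a - 1)" for a
  proof (cases "a = 1")
    case True
    then show ?thesis using u1 by simp
  next
    case False
    then have "bad (a - 1)" "1 \<le> a - 1" using that by auto
    then show ?thesis using bad_le[of "a - 1"] m(3)[of "a - 1"] by (auto simp: bad_def)
  qed
  \<comment> \<open>At \<open>c - 1\<close> the condition on \<open>l c\<close> is void. So all
    indices below \<open>c\<close> are bad when \<open>c \<le> x\<close>, and \<open>u\<close> is
    kept across the boundary at \<open>c\<close>.\<close>
  have top_bad: "bad (c - 1)" if "c \<le> x" "c \<noteq> 1"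
    using that y pos by (auto simp: bad_def)
  have bad_prev: "a = 1 \<or> bad (a - 1)" if "bad a" for a
    using bad_down[of "a - 1"] that by (cases "a = 1") (auto simp: bad_def)
  have u'_cases: "a < c \<and> u' a = l a + 1 \<and> \<not> bad a
        \<and> ((a = 1 \<or> bad (a - 1)) \<longrightarrow> u a = l (a - 1) \<and> l (a - 1) = l a)
      \<or> u' a = u a \<and> u a \<le> l (a - 1) \<and> (a < c \<longrightarrow> (a = 1 \<or> bad (a - 1)) \<and> (u a = l a \<longrightarrow> bad a))
      \<or> u' a = u a \<and> c < a" if "1 \<le> a" "a \<le> x" for a
  proof (cases "a < c")
    case True
    show ?thesis
    proof (cases "(a = 1 \<or> bad (a - 1)) \<and> (bad a \<or> u a \<noteq> l (a - 1) \<or> l (a - 1) \<noteq> l a)")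
      case True
      then show ?thesis
        using u_le[of a] start_le[of a] that \<open>a < c\<close> by (auto simp: u'_def)
    next
      case False
      then show ?thesis
        using bad_prev[of a] \<open>a < c\<close> by (auto simp: u'_def)
    qed
  next
    case False
    then show ?thesis
      using u_le[of c] top_bad pos that by (cases "a = c") (auto simp: u'_def)
  qed
  have u'_sing: "1 \<le> u' a \<and> 0 < S' a (u' a)" if a: "1 \<le> a" "a \<le> x" for a
    using u'_cases[OF a]
  proof (elim disjE)
    assume "a < c \<and> u' a = l a + 1 \<and> \<not> bad a
      \<and> ((a = 1 \<or> bad (a - 1)) \<longrightarrow> u a = l (a - 1) \<and> l (a - 1) = l a)"
    then show ?thesis using new_string a by simp
  next
    assume h: "u' a = u a \<and> u a \<le> l (a - 1) \<and> (a < c \<longrightarrow> (a = 1 \<or> bad (a - 1)) \<and> (u a = l a \<longrightarrow> bad a))"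
    consider "a < c" | "a = c" | "c < a" by linarith
    then show ?thesis
    proof cases
      case 1
      \<comment> \<open>Here \<open>m a \<le> l a = u a \<le> u (a + 1) \<le> m a\<close>, so
        \<open>u a\<close> and \<open>m a\<close> are twins.\<close>
      have "2 \<le> S a (u a)" if "u a = l a"
      proof -
        have "bad a" using h that 1 by blast
        then have "a < y" "m a \<le> u a" using bad_le[of a] that by (auto simp: bad_def)
        then have "u a = m a" using u_mono[of a] m(3)[of a] a y by simp
        then show ?thesis using m(4)[of a] a \<open>a < y\<close> by simp
      qed
      then have "0 < S' a (u a)"
        using survive[of a "u a"] u[OF a] a 1 h by (cases "u a = l a") auto
      then show ?thesis using h u[OF a] by simp
    next
      case 2
      then show ?thesis using survive_top[of "u c"] u[OF a] h by simp
    next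
      case 3
      then show ?thesis using survive_above u[OF a] h by simp
    qed
  next
    assume "u' a = u a \<and> c < a"
    then show ?thesis using survive_above u[OF a] by simp
  qed
  have u'_bad: "u' a = u a" if "bad a" for a
    using bad_prev[OF that] that by (auto simp: u'_def)
  have u'_mono: "u' a \<le> u' (a + 1)" if a: "1 \<le> a" "a < x" for a
  proof (cases "a + 1 < c")
    case True
    show ?thesis
    proof (cases "u' (a + 1) = l (a + 1) + 1")
      case True
      have "u' a \<le> l a + 1"
        using u'_cases[of a] a start_le[of a] \<open>a + 1 < c\<close> by auto
      then show ?thesis
        using True sel_mono[of a] a \<open>a + 1 < c\<close> by simp
    next
      case False
      then have "u' (a + 1) = u (a + 1)" "bad a"
        using True a by (auto simp: u'_def split: if_splits)
      then show ?thesis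
        using u'_bad[of a] u_mono[of a] a by simp
    qed
  next
    case False
    then have u_Suc: "u' (a + 1) = u (a + 1)"
      by (simp add: u'_def)
    have "u' a = u a"
    proof (cases "a < c")
      case True
      then have "a = c - 1" using False by simp
      then have "bad a" using top_bad a pos by simp
      then show ?thesis by (rule u'_bad)
    qed (simp add: u'_def)
    then show ?thesis
      using u_Suc u_mono[of a] a by simp
  qed
  have u'_1: "u' 1 \<le> l 0 + 1"
    using u1 by (auto simp: u'_def)
  have m_surv: "S a (m a) + (if m a = l a + 1 then 1 else 0) \<le> S' a (m a)"
    if "1 \<le> a" "a < y" "\<not> bad a" for a
    using survive[of a "m a"] good[OF that] m(1)[of a] that by auto
  have m'_sing: "1 \<le> m' a \<and> 0 < S' a (m' a)" if a: "1 \<le> a" "a < y" for a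
    using m_surv[OF a] m(1,2)[OF a] new_string[of a] a y by (auto simp: m'_def)
  have m'_mono: "m' a \<le> m' (a + 1)" if a: "1 \<le> a" "a + 1 < y" for a
  proof -
    have "l a \<le> l (a + 1)" "m a \<le> m (a + 1)"
      using sel_mono[of a] m_mono[of a] a y by auto
    then show ?thesis
      using good[of "a + 1"] bad_down[of a] a by (auto simp: m'_def)
  qed
  have u'_m': "u' (a + 1) \<le> m' a" if a: "1 \<le> a" "a < y" for a
  proof (cases "bad a")
    case True
    then show ?thesis
      using bad_le[of a] m(3)[OF a] a by (auto simp: u'_def m'_def)
  next
    case False
    then show ?thesis
      using good[OF a] a by (auto simp: u'_def m'_def)
  qed
  \<comment> \<open>At a bad index equality is impossible, as
    \<open>u a \<le> m a \<le> l a\<close>. Elsewhere it forces \<open>m a = l a + 1\<close>, so the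
    new string is a twin of the surviving one.\<close>
  have two: "2 \<le> S' a (m' a)" if a: "1 \<le> a" "a < y" and eq: "u' a = m' a" for a
  proof (cases "bad a")
    case True
    then show ?thesis
      using u'_bad[of a] bad_le[of a] m(3)[OF a] u_mono[of a] a y eq by (auto simp: m'_def)
  next
    case False
    then have "l a < m a" "u' a = m a" "a < c"
      using good[OF a] eq by (auto simp: m'_def)
    then have "m a = l a + 1"
      using u'_cases[of a] start_le[of a] a y by auto
    then show ?thesis
      using m_surv[OF a False] m(2)[OF a] False by (auto simp: m'_def)
  qed
  have "interlaced S' (l 0 + 1) x y u' m'"
    unfolding interlaced_def chain_def using u'_sing u'_mono u'_1 m'_sing m'_mono u'_m' two by auto
  then show ?thesis
    unfolding y_def by blast
qed

end

section \<open>Configurations realize the abstract letter step\<close>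

definition num_rows :: "nat \<Rightarrow> configuration \<Rightarrow> nat" where
  "num_rows n C = size (filter_mset (\<lambda>r. r \<noteq> 0) (shape n C 1))"

definition box_positions :: "nat \<Rightarrow> nat \<Rightarrow> nat \<Rightarrow> configuration \<Rightarrow> nat \<Rightarrow> nat" where
  "box_positions n k c C a = (if a = 0 then k - 1 else selected n C c a)"

lemma selection_box_positions: "selection (sing n C) c (box_positions n k c C)"
  by (rule selection_selected) (simp add: box_positions_def)

lemma strings_process_letter:
  "strings (process_letter n k c C) a =
    (if 1 \<le> a \<and> a < c
     then strings C a - {#(selected n C c a, vacancy (shape n C) a (selected n C c a))#}
       + {#(selected n C c a + 1,
            vacancy (\<lambda>a. if a = 0 then add_box (k - 1) (shape n C 0)
              else if a \<le> c - 1 then add_box (selected n C c a) (shape n C a)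
              else shape n C a) a (selected n C c a + 1))#}
     else strings C a)"
  by (auto simp: process_letter_def Let_def)

lemma rows0_process_letter: "rows0 (process_letter n k c C) = add_box (k - 1) (rows0 C)"
  by (simp add: process_letter_def Let_def shape_def)

lemma Q_replace_string:
  assumes "l = 0 \<or> (l, v) \<in># T"
  shows "Q i (image_mset fst (T - {#(l, v)#} + {#(l + 1, w)#}))
    = Q i (image_mset fst T) + (if l < i then 1 else 0)"
proof (cases "(l, v) \<in># T")
  case True
  then obtain T' where "T = add_mset (l, v) T'"
    by (meson mset_add)
  then show ?thesis
    by (auto simp: Q_def min_def)
next
  case False
  with assms show ?thesis
    by (auto simp: Q_def min_def diff_single_trivial)
qed

context
  fixes n k c :: nat and C :: configuration
  assumes c: "1 \<le> c" "c \<le> n" and row: "k - 1 = 0 \<or> k - 1 \<in># rows0 C"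
begin

private abbreviation "C' \<equiv> process_letter n k c C"
private abbreviation "l \<equiv> box_positions n k c C"
private abbreviation "box a i \<equiv> (if a < c \<and> l a < i then 1 else 0 :: int)"
private abbreviation "\<eta>' \<equiv> (\<lambda>a. if a = 0 then add_box (k - 1) (shape n C 0)
              else if a \<le> c - 1 then add_box (selected n C c a) (shape n C a)
              else shape n C a)"

lemma selected_string:
  assumes "1 \<le> a" "a < c"
  shows "selected n C c a = 0 \<or>
    (selected n C c a, vacancy (shape n C) a (selected n C c a)) \<in># strings C a"
  using selection.sel_singular[OF selection_box_positions assms] assms
  by (auto simp: sing_def box_positions_def)

lemma Q_shape_process_letter: "Q i (shape n C' a) = Q i (shape n C a) + box a i"
proof -
  consider "a = 0" | "1 \<le> a" "a < c" | "c \<le> a" "a \<noteq> 0" by linarith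
  then show ?thesis
  proof cases
    case 1
    then show ?thesis
      using c row by (simp add: shape_def rows0_process_letter box_positions_def Q_add_box)
  next
    case 2
    then have "shape n C' a = image_mset fst (strings C' a)"
        "shape n C a = image_mset fst (strings C a)"
      using c by (auto simp: shape_def)
    then show ?thesis
      using Q_replace_string[OF selected_string[OF 2]] 2
      unfolding strings_process_letter by (simp add: box_positions_def)
  next
    case 3
    then show ?thesis
      by (auto simp: shape_def strings_process_letter)
  qed
qed

text \<open>New riggings are computed from the intermediate shapes \<open>\<eta>'\<close>,
  singularity from the stored strings; equal values of \<open>Q\<close> make the vacancy numbers
  agree.\<close>

lemma Q_added_boxes: "Q i (\<eta>' a) = Q i (shape n C a) + box a i"
proof -
  consider "a = 0" | "1 \<le> a" "a < c" | "c \<le> a" "a \<noteq> 0" by linarith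
  then show ?thesis
  proof cases
    case 1
    then show ?thesis
      using c row by (simp add: shape_def box_positions_def Q_add_box)
  next
    case 2
    have "selected n C c a = 0 \<or> selected n C c a \<in># shape n C a"
      using selected_string[OF 2] 2 c by (force simp: shape_def)
    moreover have "a \<le> c - 1"
      using 2 by simp
    ultimately show ?thesis
      using 2 by (simp add: Q_add_box box_positions_def)
  next
    case 3
    then show ?thesis
      using c by auto
  qed
qed

lemma vacancy_process_letter:
  "vacancy (shape n C') a i = vacancy (shape n C) a i + box (a - 1) i - 2 * box a i + box (a + 1) i"
  by (simp add: vacancy_def Q_shape_process_letter)

lemma strings_process_letter':
  assumes "1 \<le> a" "a < c"
  shows "strings C' a = strings C a - {#(l a, vacancy (shape n C) a (l a))#}
    + {#(l a + 1, vacancy (shape n C') a (l a + 1))#}"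
proof -
  have "vacancy \<eta>' a i = vacancy (shape n C') a i" for i
    unfolding vacancy_def Q_shape_process_letter Q_added_boxes ..
  then show ?thesis
    using assms unfolding strings_process_letter by (simp add: box_positions_def)
qed

text \<open>The three terms in the change of the vacancy number all vanish for
  \<open>i \<le> l (a - 1)\<close>, and add up to 1 - 2 + 1 = 0 for \<open>i\<close> above
  \<open>l (a + 1)\<close> when \<open>a + 1 < c\<close>.\<close>

lemma letter_step_process_letter:
  assumes start: "2 \<le> c \<Longrightarrow> k - 1 \<le> selected n C c 1"
  shows "letter_step (sing n C) c l (sing n C')"
proof -
  interpret selection "sing n C" c l
    by (rule selection_box_positions)
  have start': "l 0 \<le> l 1" if "2 \<le> c"
    using start that by (simp add: box_positions_def)
  show ?thesis
  proof
    fix a i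
    assume a: "1 \<le> a" "a < c" and i: "1 \<le> i" "i \<le> l (a - 1) \<or> (a + 1 < c \<and> l (a + 1) < i)"
    have "l (a - 1) \<le> l a"
      using start' sel_mono[of "a - 1"] a by (cases "a = 1") auto
    moreover have "a + 1 < c \<Longrightarrow> l a \<le> l (a + 1)"
      using sel_mono a by simp
    ultimately have v: "vacancy (shape n C') a i = vacancy (shape n C) a i"
      using i a unfolding vacancy_process_letter by auto
    show "sing n C a i + (if i = l a + 1 then 1 else 0) \<le> sing n C' a i + (if i = l a then 1 else 0)"
      using v unfolding sing_def strings_process_letter'[OF a] by auto
  next
    fix a
    assume a: "1 \<le> a" "a < c"
    show "0 < sing n C' a (l a + 1)"
      unfolding sing_def strings_process_letter'[OF a] by simp
  next
    fix i
    assume i: "1 \<le> i" "i \<le> l (c - 1)"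
    then have "vacancy (shape n C') c i = vacancy (shape n C) c i"
      using c unfolding vacancy_process_letter by auto
    then show "sing n C c i \<le> sing n C' c i"
      by (simp add: sing_def strings_process_letter)
  next
    fix a i
    assume "c < a"
    then have "vacancy (shape n C') a i = vacancy (shape n C) a i"
      unfolding vacancy_process_letter by auto
    then show "sing n C' a i = sing n C a i"
      using \<open>c < a\<close> by (simp add: sing_def strings_process_letter)
  qed (use c start' in auto)
qed

lemma num_rows_process_letter:
  assumes "2 \<le> n"
  shows "num_rows n C' = num_rows n C + (if 2 \<le> c \<and> selected n C c 1 = 0 then 1 else 0)"
proof (cases "2 \<le> c")
  case True
  define v where "v = vacancy (shape n C) 1 (l 1)"
  have l1: "l 1 = 0 \<or> (l 1, v) \<in># strings C 1"
    using selected_string[of 1] True by (simp add: box_positions_def v_def)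
  have r: "num_rows n D = size (filter_mset (\<lambda>r. r \<noteq> 0) (image_mset fst (strings D 1)))" for D
    using assms by (simp add: num_rows_def shape_def)
  have *: "strings C' 1 = strings C 1 - {#(l 1, v)#} + {#(l 1 + 1, vacancy (shape n C') 1 (l 1 + 1))#}"
    using strings_process_letter'[of 1] True by (simp add: v_def)
  have sel: "selected n C c 1 = l 1"
    by (simp add: box_positions_def)
  show ?thesis
  proof (cases "(l 1, v) \<in># strings C 1")
    case T: True
    then obtain T' where "strings C 1 = add_mset (l 1, v) T'"
      by (meson mset_add)
    then show ?thesis
      using True * sel by (simp add: r)
  next
    case False
    then show ?thesis
      using l1 True * sel by (simp add: r diff_single_trivial)
  qed
next
  case False
  then have "strings C' 1 = strings C 1"
    by (simp add: strings_process_letter)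
  then show ?thesis
    using False assms by (simp add: num_rows_def shape_def)
qed

end

section \<open>The letters of one tableau\<close>

lemma row_process_letter: "k \<in># rows0 (process_letter n k c C)" if "1 \<le> k"
  using that by (simp add: rows0_process_letter add_box_def)

text \<open>Two invariants run in parallel after the letter \<open>d\<close>. The chain
  \<open>v\<close> makes the next letter, if at least 2, select a length at least \<open>k\<close>
  in \<open>strings C 1\<close>, so no row is created; the pair \<open>u\<close>, \<open>m\<close>
  preserves the chain of length \<open>x\<close>.\<close>

lemma process_next_letters:
  assumes "2 \<le> n" "sorted_wrt (\<ge>) (d # ds)" "set (d # ds) \<subseteq> {1..n}"
    and "k \<in># rows0 C" "1 \<le> k" "chain (sing n C) k (d - 1) v"
    and "interlaced (sing n C) k x (min x d) u m"
  shows "\<exists>u m y. num_rows n (fold (\<lambda>(k, c). process_letter n k c) (enumerate (k + 1) ds) C) = num_rows n C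
    \<and> interlaced (sing n (fold (\<lambda>(k, c). process_letter n k c) (enumerate (k + 1) ds) C)) (k + length ds) x y u m"
  using assms(2-)
proof (induction ds arbitrary: d k C v u m)
  case Nil
  then show ?case by auto
next
  case (Cons c ds)
  let ?C = "process_letter n (k + 1) c C"
  let ?l = "box_positions n (k + 1) c C"
  have c: "1 \<le> c" "c \<le> n" "c \<le> d" and row: "k + 1 - 1 = 0 \<or> k + 1 - 1 \<in># rows0 C"
    using Cons.prems by auto
  interpret sel: selection "sing n C" c ?l
    by (rule selection_box_positions)
  have sel_ge: "k \<le> selected n C c 1" if "2 \<le> c"
  proof -
    have "v 1 \<le> ?l 1"
      using sel.chain_le_selected[of 1 "c - 1" v] Cons.prems(5) that c by (auto simp: chain_def)
    moreover have "k \<le> v 1"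
      using Cons.prems(5) that c by (auto simp: chain_def)
    ultimately show ?thesis
      by (simp add: box_positions_def)
  qed
  interpret letter_step "sing n C" c ?l "sing n ?C"
    using letter_step_process_letter[OF c(1,2) row] sel_ge by simp
  have l0: "?l 0 = k"
    by (simp add: box_positions_def)
  have rows: "num_rows n ?C = num_rows n C"
    using num_rows_process_letter[OF c(1,2) row \<open>2 \<le> n\<close>] sel_ge Cons.prems(4) by auto
  have "interlaced (sing n C) (?l 0) x (min x c) u m"
    using Cons.prems(6) c l0 by (auto intro: interlaced_mono)
  then obtain u' m' where "interlaced (sing n ?C) (k + 1) x (min x c) u' m'"
    using interlaced_step l0 by metis
  moreover have "\<exists>v. chain (sing n ?C) (k + 1) (c - 1) v"
    using chain_selected l0 c by (cases "c = 1") auto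
  ultimately show ?case
    using Cons.IH[of c "k + 1" ?C _ u' m'] Cons.prems row_process_letter[of "k + 1" n c C] rows
    by (auto simp: ac_simps)
qed

lemma process_row_chain:
  assumes n: "2 \<le> n" and b: "sorted b" "set b \<subseteq> {1..n}" and chain: "chain (sing n C) 1 t v"
  shows "num_rows n (process_row n b C) = num_rows n C \<or>
    num_rows n (process_row n b C) = num_rows n C + 1 \<and> t + 1 < n
      \<and> (\<exists>v. chain (sing n (process_row n b C)) 1 (t + 1) v)"
proof (cases "rev b")
  case Nil
  then show ?thesis by (simp add: process_row_def)
next
  case (Cons c ds)
  let ?C = "process_letter n 1 c C"
  let ?l = "box_positions n 1 c C"
  have desc: "sorted_wrt (\<ge>) (c # ds)"
    using b(1) Cons by (metis sorted_wrt_rev rev_rev_ident)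
  have set: "set (c # ds) \<subseteq> {1..n}"
    using b(2) Cons by (metis set_rev)
  then have c: "1 \<le> c" "c \<le> n" by auto
  have row: "(1 :: nat) - 1 = 0 \<or> 1 - 1 \<in># rows0 C" by simp
  interpret letter_step "sing n C" c ?l "sing n ?C"
    using letter_step_process_letter[OF c row] by simp
  have l0: "?l 0 = 0" and l1: "?l 1 = selected n C c 1"
    by (auto simp: box_positions_def)
  have row': "1 \<in># rows0 ?C"
    by (rule row_process_letter) simp
  have top: "\<exists>v. chain (sing n ?C) 1 (c - 1) v"
    using chain_selected l0 c by (cases "c = 1") auto
  have C': "process_row n b C = fold (\<lambda>(k, c). process_letter n k c) (enumerate (1 + 1) ds) ?C"
    using Cons by (simp add: process_row_def numeral_2_eq_2)
  note rows = num_rows_process_letter[OF c row n]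
  note next_letters = process_next_letters[OF n desc set row' order_refl, folded C']
  show ?thesis
  proof (cases "2 \<le> c \<and> selected n C c 1 = 0")
    case True
    then have tc: "t + 1 < c" and int: "interlaced (sing n ?C) 1 (t + 1) (t + 1) (\<lambda>a. ?l a + 1) v"
      using chain_interlaced[OF chain l0] l1 by auto
    have "interlaced (sing n ?C) 1 (t + 1) (min (t + 1) c) (\<lambda>a. ?l a + 1) v"
      using int by (rule interlaced_mono) simp
    then obtain u m y where *: "num_rows n (process_row n b C) = num_rows n ?C"
        "interlaced (sing n (process_row n b C)) (1 + length ds) (t + 1) y u m"
      using next_letters top by blast
    then show ?thesis
      using rows True tc c by (auto simp: interlaced_def)
  next
    case False
    \<comment> \<open>No chain needs to be carried here, so the invariant is used with
      \<open>x = 0\<close>, where it is trivial.\<close>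
    have "interlaced (sing n ?C) 1 0 (min 0 c) (\<lambda>_. 0) v"
      by (simp add: interlaced_def)
    then have "num_rows n (process_row n b C) = num_rows n ?C"
      using next_letters top by blast
    then show ?thesis
      using rows False by auto
  qed
qed

section \<open>Induction over the tableaux and the final bound\<close>

text \<open>\<open>z\<close> counts the tableaux that create no row, and \<open>t\<close> those
  processed since the last of these.\<close>

lemma Phi_chain:
  assumes "2 \<le> n" "\<forall>b\<in>set p. sorted b \<and> set b \<subseteq> {1..n}"
  shows "\<exists>z t v. t < n \<and> chain (sing n (Phi n p)) 1 t v
    \<and> num_rows n (Phi n p) + z \<le> length p \<and> length p \<le> n * z + t"
  using assms(2)
proof (induction p rule: rev_induct)
  case Nil
  have "num_rows n (Phi n []) = 0"
    by (simp add: num_rows_def Phi_def empty_configuration_def shape_def)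
  then show ?case
    using assms(1) by (intro exI[of _ 0]) auto
next
  case (snoc b p)
  then obtain z t v where IH: "t < n" "chain (sing n (Phi n p)) 1 t v"
      "num_rows n (Phi n p) + z \<le> length p" "length p \<le> n * z + t"
    by auto
  have Phi: "Phi n (p @ [b]) = process_row n b (Phi n p)"
    by (simp add: Phi_def)
  have "sorted b" "set b \<subseteq> {1..n}"
    using snoc.prems by auto
  from process_row_chain[OF assms(1) this IH(2)] show ?case
  proof (elim disjE)
    assume "num_rows n (process_row n b (Phi n p)) = num_rows n (Phi n p)"
    \<comment> \<open>Resetting \<open>t\<close> to 0 is paid for by one more \<open>n\<close>,
      because \<open>t + 1 \<le> n\<close>.\<close>
    then show ?thesis
      using IH assms(1) by (intro exI[of _ "z + 1"] exI[of _ 0] exI[of _ v]) (simp add: Phi)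
  next
    assume *: "num_rows n (process_row n b (Phi n p)) = num_rows n (Phi n p) + 1 \<and> t + 1 < n
      \<and> (\<exists>v. chain (sing n (process_row n b (Phi n p))) 1 (t + 1) v)"
    then obtain v' where "chain (sing n (process_row n b (Phi n p))) 1 (t + 1) v'" by blast
    then show ?thesis
      using IH * by (intro exI[of _ z] exI[of _ "t + 1"] exI[of _ v']) (simp add: Phi)
  qed
qed

lemma listset_map_row_crystal:
  "p \<in> listset (map (row_crystal n) s) \<Longrightarrow>
    length p = length s \<and> (\<forall>b\<in>set p. sorted b \<and> set b \<subseteq> {1..n})"
proof (induction s arbitrary: p)
  case (Cons k s)
  obtain b q where p: "p = b # q" and b: "b \<in> row_crystal n k"
      and q: "q \<in> listset (map (row_crystal n) s)"
    using Cons.prems by (auto simp: set_Cons_def)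
  have "sorted b \<and> set b \<subseteq> {1..n}"
    using b by (simp add: row_crystal_def)
  then show ?case
    using Cons.IH[OF q] p by auto
qed simp

theorem corollary6p4:
  fixes n m :: nat and s :: "nat list" and p :: "nat list list"
  assumes "n \<ge> 2" and "m \<ge> 1"
    and "length s = m" and "\<forall>x \<in> set s. x > 0"
    and "p \<in> paths n s"
  shows "int (num_solitons n p) \<le> \<lceil>(real n - 1) * real m / real n\<rceil>"
proof -
  have p: "length p = m" "\<forall>b\<in>set p. sorted b \<and> set b \<subseteq> {1..n}"
    using listset_map_row_crystal[of p n s] assms by (auto simp: paths_def)
  obtain z t where zt: "t < n" "num_rows n (Phi n p) + z \<le> m" "m \<le> n * z + t"
    using Phi_chain[OF assms(1) p(2)] p(1) by blast
  define N where "N = num_solitons n p"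
  have N: "N + z \<le> m"
    using zt(2) by (simp add: N_def num_solitons_def soliton_lengths_def num_rows_def)
  have "m < n * z + n"
    using zt by simp
  then have m: "real m < real n * real z + real n"
    by (metis of_nat_add of_nat_less_iff of_nat_mult)
  \<comment> \<open>Eliminating \<open>z\<close> leaves a strict bound on \<open>N - 1\<close>,
    which is exactly what the ceiling requires.\<close>
  have "real n * (real N + real z) \<le> real n * real m"
    using N by (intro mult_left_mono) (simp_all flip: of_nat_add)
  with m have "(real N - 1) * real n < (real n - 1) * real m"
    by (simp add: algebra_simps)
  then have "real N - 1 < (real n - 1) * real m / real n"
    using assms(1) by (simp add: pos_less_divide_eq)
  then have "int N \<le> \<lceil>(real n - 1) * real m / real n\<rceil>"
    by (simp add: le_ceiling_iff)
  then show ?thesis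
    by (simp add: N_def)
qed

end
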